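(* Let $\mathcal{A}$ be a complex Banach algebra with identity $1$, let $a,b,c\in\mathcal{A}$, and let $M=\begin{pmatrix} a & b\\ c & 0\end{pmatrix}\in M_2(\mathcal{A})$. If $a\in\mathcal{A}^d$, $bca^{\pi}=0$ and $a^dbc=bca^d$, then the following are equivalent: (1) $M\in M_2(\mathcal{A})^d$, i.e. $M$ has a g-Drazin inverse in $M_2(\mathcal{A})$; (2) $bc\in\mathcal{A}^d$, i.e. $bc$ has a g-Drazin inverse in $\mathcal{A}$.
   Context: $M_2(\mathcal{A})$ is the algebra of $2\times 2$ matrices over $\mathcal{A}$, regarded as a Banach algebra in the usual way (with any of the standard equivalent norms). An element $w$ of a Banach algebra $\mathcal{B}$ is quasinilpotent if $\lim_{n\to\infty}\|w^n\|^{1/n}=0$; $\mathcal{B}^{qnil}$ denotes the set of quasinilpotent elements of $\mathcal{B}$. An element $x\in\mathcal{B}$ has a g-Drazin inverse (generalized Drazin inverse) if there exists $y\in\mathcal{B}$ such that $xy=yx$, $y=yxy$ and $x-x^2y\in\mathcal{B}^{qnil}$; such $y$ is unique if it exists and is denoted $x^d$. $\mathcal{B}^d$ denotes the set of all elements of $\mathcal{B}$ having a g-Drazin inverse. For $a\in\mathcal{A}^d$, $a^{\pi}=1-aa^d$. *)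

theory Defs
  imports "HOL-Analysis.Analysis"
begin

section \<open>Complex Banach algebras with identity\<close>

class scaleC =
  fixes scaleC :: "complex \<Rightarrow> 'a \<Rightarrow> 'a"  (infixr "*\<^sub>C" 75)

text \<open>
  The identity comes from \<^class>\<open>monoid_mult\<close> rather than from \<^class>\<open>real_normed_algebra_1\<close>,
  so neither \<open>norm 1 = 1\<close> nor \<open>0 \<noteq> 1\<close> is assumed.
\<close>

class complex_banach_algebra_1 = real_normed_algebra + banach + monoid_mult + scaleC +
  assumes scaleR_scaleC: "r *\<^sub>R x = complex_of_real r *\<^sub>C x"
    and scaleC_add_right: "z *\<^sub>C (x + y) = z *\<^sub>C x + z *\<^sub>C y"
    and scaleC_add_left: "(z + w) *\<^sub>C x = z *\<^sub>C x + w *\<^sub>C x"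
    and scaleC_scaleC: "z *\<^sub>C (w *\<^sub>C x) = (z * w) *\<^sub>C x"
    and scaleC_one: "1 *\<^sub>C x = x"
    and mult_scaleC_left: "(z *\<^sub>C x) * y = z *\<^sub>C (x * y)"
    and mult_scaleC_right: "x * (z *\<^sub>C y) = z *\<^sub>C (x * y)"
    and norm_scaleC: "norm (z *\<^sub>C x) = cmod z * norm x"


section \<open>The generalized Drazin inverse\<close>

definition quasinilpotent :: "'a::complex_banach_algebra_1 \<Rightarrow> bool" where
  "quasinilpotent w \<longleftrightarrow> (\<lambda>n. root n (norm (w ^ n))) \<longlonglongrightarrow> 0"

definition is_gdrazin_inverse :: "'a::complex_banach_algebra_1 \<Rightarrow> 'a \<Rightarrow> bool" where
  "is_gdrazin_inverse x y \<longleftrightarrow>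
     x * y = y * x \<and> y = y * x * y \<and> quasinilpotent (x - x\<^sup>2 * y)"

definition has_gdrazin_inverse :: "'a::complex_banach_algebra_1 \<Rightarrow> bool" where
  "has_gdrazin_inverse x \<longleftrightarrow> (\<exists>y. is_gdrazin_inverse x y)"

definition gdrazin_inverse :: "'a::complex_banach_algebra_1 \<Rightarrow> 'a"  ("(_\<^sup>d)" [1000] 999) where
  "x\<^sup>d = (THE y. is_gdrazin_inverse x y)"

definition spectral_idempotent :: "'a::complex_banach_algebra_1 \<Rightarrow> 'a"  ("(_\<^sup>\<pi>)" [1000] 999) where
  "x\<^sup>\<pi> = 1 - x * x\<^sup>d"

lemma commuting_power_mult:
  fixes x y :: "'a::monoid_mult"
  assumes "x * y = y * x"
  shows "(x * y) ^ n = x ^ n * y ^ n"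
proof (induction n)
  case (Suc n)
  have "y * x ^ n = x ^ n * y"
    using power_commuting_commutes[of x y n] assms by simp
  then have "x * y * (x ^ n * y ^ n) = x * x ^ n * (y * y ^ n)"
    by (metis mult.assoc)
  with Suc show ?case by simp
qed simp

lemma idempotent_power:
  fixes e :: "'a::monoid_mult"
  assumes "e * e = e" "n > 0"
  shows "e ^ n = e"
  using assms(2) by (induction n rule: nat_induct_non_zero) (use assms(1) in auto)

lemma norm_power_le_power_norm:
  fixes y :: "'a::complex_banach_algebra_1"
  assumes "n > 0"
  shows "norm (y ^ n) \<le> norm y ^ n"
  using assms
proof (induction n rule: nat_induct_non_zero)
  case (Suc n)
  have "norm (y ^ Suc n) \<le> norm y * norm (y ^ n)" by (simp add: norm_mult_ineq)
  also have "\<dots> \<le> norm y * norm y ^ n" by (intro mult_left_mono Suc.IH) auto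
  finally show ?case by simp
qed simp

lemma quasinilpotent_power_norm_tendsto_0:
  fixes w :: "'a::complex_banach_algebra_1"
  assumes "quasinilpotent w" "K \<ge> 0"
  shows "(\<lambda>n. K ^ n * norm (w ^ n)) \<longlonglongrightarrow> 0"
proof (rule tendsto_sandwich[where f = "\<lambda>_. 0" and h = "\<lambda>n. (1/2::real) ^ n"])
  have "\<forall>\<^sub>F n in sequentially. root n (norm (w ^ n)) < 1 / (2 * (K + 1))"
    using assms by (intro order_tendstoD(2)) (auto simp: quasinilpotent_def)
  with eventually_gt_at_top[of "0::nat"]
  show "\<forall>\<^sub>F n in sequentially. K ^ n * norm (w ^ n) \<le> (1/2) ^ n"
  proof eventually_elim
    case (elim n)
    have "norm (w ^ n) = root n (norm (w ^ n)) ^ n"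
      using elim(1) by simp
    also have "\<dots> \<le> (1 / (2 * (K + 1))) ^ n"
      using elim by (intro power_mono) auto
    finally have "K ^ n * norm (w ^ n) \<le> K ^ n * (1 / (2 * (K + 1))) ^ n"
      using assms(2) by (intro mult_left_mono) auto
    also have "\<dots> = (K * (1 / (2 * (K + 1)))) ^ n"
      by (simp only: power_mult_distrib)
    also have "\<dots> \<le> (1/2) ^ n"
      using assms(2) by (intro power_mono) (auto simp: field_simps)
    finally show ?case .
  qed
qed (use assms(2) in \<open>auto intro: LIMSEQ_power_zero\<close>)

lemma gdrazin_inverse_absorb:
  fixes x y z :: "'a::complex_banach_algebra_1"
  assumes y: "is_gdrazin_inverse x y" and z: "is_gdrazin_inverse x z"
  shows "x * y * (x * z) = x * y" and "x * z * (x * y) = x * y"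
proof -
  define w where "w = x - x\<^sup>2 * z"
  have xy: "x * y = y * x" and yy: "y = y * x * y" and xz: "x * z = z * x" and zz: "z = z * x * z"
    and w: "quasinilpotent w"
    using y z by (simp_all add: is_gdrazin_inverse_def w_def)
  define q where "q = 1 - x * z"
  have qq: "q * q = q"
  proof -
    have "x * z * (x * z) = x * z" using zz by (metis mult.assoc)
    then show ?thesis by (simp add: q_def left_diff_distrib right_diff_distrib)
  qed
  have xq: "x * q = q * x"
  proof -
    have "x * (x * z) = x * z * x" using xz by (metis mult.assoc)
    then show ?thesis by (simp add: q_def left_diff_distrib right_diff_distrib)
  qed
  have wq: "w = x * q"
    by (simp add: w_def q_def algebra_simps power2_eq_square)
  have ee: "(x * y) * (x * y) = x * y"
    using yy by (metis mult.assoc)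
  have wn: "w ^ n = x ^ n * q" if "n > 0" for n
    using commuting_power_mult[OF xq, of n] idempotent_power[OF qq that] wq by simp
  have en: "x * y = y ^ n * x ^ n" "x * y = x ^ n * y ^ n" if "n > 0" for n
    using commuting_power_mult[OF xy, of n] commuting_power_mult[OF xy[symmetric], of n]
      idempotent_power[OF ee that] xy by simp_all
  have xqn: "x ^ n * q = q * x ^ n" for n
    using power_commuting_commutes[of x q n] xq by simp
  have b1: "norm (x * y * q) \<le> norm y ^ n * norm (w ^ n)" if "n > 0" for n
  proof -
    have "x * y * q = y ^ n * w ^ n"
      using en(1)[OF that] wn[OF that] by (simp add: mult.assoc)
    then have "norm (x * y * q) \<le> norm (y ^ n) * norm (w ^ n)"
      by (simp add: norm_mult_ineq)
    also have "\<dots> \<le> norm y ^ n * norm (w ^ n)"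
      by (intro mult_right_mono norm_power_le_power_norm that) auto
    finally show ?thesis .
  qed
  have b2: "norm (q * (x * y)) \<le> norm y ^ n * norm (w ^ n)" if "n > 0" for n
  proof -
    have "q * (x * y) = w ^ n * y ^ n"
      using en(2)[OF that] wn[OF that] xqn[of n] by (simp add: mult.assoc[symmetric])
    then have "norm (q * (x * y)) \<le> norm (w ^ n) * norm (y ^ n)"
      by (simp add: norm_mult_ineq)
    also have "\<dots> \<le> norm (w ^ n) * norm y ^ n"
      by (intro mult_left_mono norm_power_le_power_norm that) auto
    finally show ?thesis by (simp add: mult.commute)
  qed
  have lim: "(\<lambda>n. norm y ^ n * norm (w ^ n)) \<longlonglongrightarrow> 0"
    by (rule quasinilpotent_power_norm_tendsto_0[OF w]) simp
  have "norm (x * y * q) \<le> 0"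
    using eventually_mono[OF eventually_gt_at_top[of "0::nat"] b1]
    by (intro tendsto_lowerbound[OF lim]) auto
  then show "x * y * (x * z) = x * y"
    by (simp add: q_def right_diff_distrib)
  have "norm (q * (x * y)) \<le> 0"
    using eventually_mono[OF eventually_gt_at_top[of "0::nat"] b2]
    by (intro tendsto_lowerbound[OF lim]) auto
  then show "x * z * (x * y) = x * y"
    by (simp add: q_def left_diff_distrib)
qed

lemma gdrazin_inverse_unique:
  fixes x y z :: "'a::complex_banach_algebra_1"
  assumes y: "is_gdrazin_inverse x y" and z: "is_gdrazin_inverse x z"
  shows "y = z"
proof -
  have e: "x * y = x * z"
    using gdrazin_inverse_absorb(1)[OF y z] gdrazin_inverse_absorb(2)[OF z y] by simp
  have xy: "x * y = y * x" and yy: "y = y * x * y" and xz: "x * z = z * x" and zz: "z = z * x * z"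
    using y z by (simp_all add: is_gdrazin_inverse_def)
  have "y = y * (x * y)" using yy by (metis mult.assoc)
  also have "\<dots> = y * x * z" unfolding e by (rule mult.assoc[symmetric])
  also have "\<dots> = z * x * z" unfolding xy[symmetric] e by (simp only: xz)
  also have "\<dots> = z" by (rule zz[symmetric])
  finally show ?thesis .
qed

lemma is_gdrazin_inverse_gdrazin_inverse:
  "has_gdrazin_inverse x \<Longrightarrow> is_gdrazin_inverse x (x\<^sup>d)"
  unfolding has_gdrazin_inverse_def gdrazin_inverse_def
  by (metis gdrazin_inverse_unique theI)


section \<open>The Banach algebra of $2\times 2$ matrices\<close>

text \<open>
  A separate type is used instead of \<open>'a^2^2\<close>, whose ring multiplication and unit are componentwise.
\<close>

datatype 'a mat2 = Mat2 (m11: 'a) (m12: 'a) (m21: 'a) (m22: 'a)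

lemma mat2_eq_iff:
  "x = y \<longleftrightarrow> m11 x = m11 y \<and> m12 x = m12 y \<and> m21 x = m21 y \<and> m22 x = m22 y"
  by (cases x; cases y) auto

instantiation mat2 :: (complex_banach_algebra_1) real_normed_algebra
begin

definition "0 = Mat2 0 0 0 0"

definition "x + y = Mat2 (m11 x + m11 y) (m12 x + m12 y) (m21 x + m21 y) (m22 x + m22 y)"

definition "- x = Mat2 (- m11 x) (- m12 x) (- m21 x) (- m22 x)"

definition "x - y = Mat2 (m11 x - m11 y) (m12 x - m12 y) (m21 x - m21 y) (m22 x - m22 y)"

definition "x * y =
  Mat2 (m11 x * m11 y + m12 x * m21 y) (m11 x * m12 y + m12 x * m22 y)
       (m21 x * m11 y + m22 x * m21 y) (m21 x * m12 y + m22 x * m22 y)"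

definition "r *\<^sub>R x = Mat2 (r *\<^sub>R m11 x) (r *\<^sub>R m12 x) (r *\<^sub>R m21 x) (r *\<^sub>R m22 x)"

text \<open>The maximum row sum norm; quasinilpotency is the same for every equivalent norm.\<close>

definition "norm x = max (norm (m11 x) + norm (m12 x)) (norm (m21 x) + norm (m22 x))"

definition "sgn (x :: 'a mat2) = inverse (norm x) *\<^sub>R x"

definition "dist (x :: 'a mat2) y = norm (x - y)"

definition [code del]:
  "(uniformity :: ('a mat2 \<times> 'a mat2) filter) = (INF e\<in>{0<..}. principal {(x, y). dist x y < e})"

definition [code del]:
  "open (U :: 'a mat2 set) \<longleftrightarrow> (\<forall>x\<in>U. eventually (\<lambda>(x', y). x' = x \<longrightarrow> y \<in> U) uniformity)"

lemmas mat2_defs = zero_mat2_def plus_mat2_def uminus_mat2_def minus_mat2_def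
  times_mat2_def scaleR_mat2_def

lemma mat2_entry_norm_le:
  fixes x :: "'a mat2"
  shows "norm (m11 x) \<le> norm x" "norm (m12 x) \<le> norm x" "norm (m21 x) \<le> norm x" "norm (m22 x) \<le> norm x"
  by (auto simp: norm_mat2_def le_max_iff_disj intro: add_increasing add_increasing2)

lemma mat2_norm_le_sum:
  fixes x :: "'a mat2"
  shows "norm x \<le> norm (m11 x) + norm (m12 x) + norm (m21 x) + norm (m22 x)"
  by (auto simp: norm_mat2_def)

instance
proof
  fix x y z :: "'a mat2" and r s :: real
  show "x + y + z = x + (y + z)" "x + y = y + x" "0 + x = x" "- x + x = 0" "x - y = x + - y"
    "x * y * z = x * (y * z)" "(x + y) * z = x * z + y * z" "x * (y + z) = x * y + x * z"
    by (auto simp: mat2_defs mat2_eq_iff algebra_simps)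
  show "r *\<^sub>R (x + y) = r *\<^sub>R x + r *\<^sub>R y" "(r + s) *\<^sub>R x = r *\<^sub>R x + s *\<^sub>R x"
    "r *\<^sub>R s *\<^sub>R x = (r * s) *\<^sub>R x" "1 *\<^sub>R x = x"
    "r *\<^sub>R x * y = r *\<^sub>R (x * y)" "x * r *\<^sub>R y = r *\<^sub>R (x * y)"
    by (auto simp: mat2_defs mat2_eq_iff algebra_simps)
  show "sgn x = inverse (norm x) *\<^sub>R x" by (rule sgn_mat2_def)
  show "dist x y = norm (x - y)" by (rule dist_mat2_def)
  show "(uniformity :: ('a mat2 \<times> 'a mat2) filter) = (INF e\<in>{0<..}. principal {(x, y). dist x y < e})"
    by (rule uniformity_mat2_def)
  show "open U \<longleftrightarrow> (\<forall>x\<in>U. \<forall>\<^sub>F (x', y) in uniformity. x' = x \<longrightarrow> y \<in> U)" for U :: "'a mat2 set"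
    by (rule open_mat2_def)
  show "norm x = 0 \<longleftrightarrow> x = 0"
  proof
    assume "norm x = 0"
    then show "x = 0"
      using mat2_entry_norm_le[of x] by (auto simp: mat2_eq_iff zero_mat2_def)
  qed (simp add: norm_mat2_def zero_mat2_def)
  show "norm (x + y) \<le> norm x + norm y"
    using norm_triangle_ineq[of "m11 x" "m11 y"] norm_triangle_ineq[of "m12 x" "m12 y"]
      norm_triangle_ineq[of "m21 x" "m21 y"] norm_triangle_ineq[of "m22 x" "m22 y"]
    by (simp add: norm_mat2_def plus_mat2_def max_def)
  show "norm (r *\<^sub>R x) = \<bar>r\<bar> * norm x"
    by (simp add: norm_mat2_def scaleR_mat2_def max_mult_distrib_left ring_distribs)
  have row: "norm (p * m11 y + q * m21 y) + norm (p * m12 y + q * m22 y) \<le> (norm p + norm q) * norm y"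
    for p q :: 'a
  proof -
    have "norm (p * m11 y + q * m21 y) + norm (p * m12 y + q * m22 y)
        \<le> (norm p * norm (m11 y) + norm q * norm (m21 y)) + (norm p * norm (m12 y) + norm q * norm (m22 y))"
      by (intro add_mono order_trans[OF norm_triangle_ineq] norm_mult_ineq)
    also have "\<dots> = norm p * (norm (m11 y) + norm (m12 y)) + norm q * (norm (m21 y) + norm (m22 y))"
      by (simp add: algebra_simps)
    also have "\<dots> \<le> norm p * norm y + norm q * norm y"
      by (intro add_mono mult_left_mono) (auto simp: norm_mat2_def)
    finally show ?thesis by (simp add: algebra_simps)
  qed
  have "(norm (m11 x) + norm (m12 x)) * norm y \<le> norm x * norm y"
    "(norm (m21 x) + norm (m22 x)) * norm y \<le> norm x * norm y"
    by (intro mult_right_mono; auto simp: norm_mat2_def add_nonneg_nonneg le_max_iff_disj)+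
  with row[of "m11 x" "m12 x"] row[of "m21 x" "m22 x"]
  show "norm (x * y) \<le> norm x * norm y"
    by (subst norm_mat2_def) (simp add: times_mat2_def)
qed

end

instance mat2 :: (complex_banach_algebra_1) banach
proof
  fix X :: "nat \<Rightarrow> 'a mat2"
  assume C: "Cauchy X"
  have entry: "convergent (\<lambda>n. f (X n))"
    if f: "\<And>x y. norm (f x - f y) \<le> norm (x - y)" for f :: "'a mat2 \<Rightarrow> 'a"
  proof -
    have "Cauchy (\<lambda>n. f (X n))"
      unfolding Cauchy_def
    proof (intro allI impI)
      fix e :: real assume "e > 0"
      then obtain M where "\<forall>m\<ge>M. \<forall>n\<ge>M. dist (X m) (X n) < e"
        using C unfolding Cauchy_def by blast
      then show "\<exists>M. \<forall>m\<ge>M. \<forall>n\<ge>M. dist (f (X m)) (f (X n)) < e"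
        by (metis dist_mat2_def dist_norm f le_less_trans)
    qed
    then show ?thesis by (rule Cauchy_convergent)
  qed
  have le: "norm (m11 x - m11 y) \<le> norm (x - y)" "norm (m12 x - m12 y) \<le> norm (x - y)"
    "norm (m21 x - m21 y) \<le> norm (x - y)" "norm (m22 x - m22 y) \<le> norm (x - y)" for x y :: "'a mat2"
    using mat2_entry_norm_le[of "x - y"] by (simp_all add: minus_mat2_def)
  obtain p q r s where lims: "(\<lambda>n. m11 (X n)) \<longlonglongrightarrow> p" "(\<lambda>n. m12 (X n)) \<longlonglongrightarrow> q"
    "(\<lambda>n. m21 (X n)) \<longlonglongrightarrow> r" "(\<lambda>n. m22 (X n)) \<longlonglongrightarrow> s"
    using entry[of m11, OF le(1)] entry[of m12, OF le(2)] entry[of m21, OF le(3)] entry[of m22, OF le(4)]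
    unfolding convergent_def by blast
  have "(\<lambda>n. norm (m11 (X n) - p) + norm (m12 (X n) - q) + norm (m21 (X n) - r) + norm (m22 (X n) - s))
      \<longlonglongrightarrow> norm (p - p) + norm (q - q) + norm (r - r) + norm (s - s)"
    by (intro tendsto_intros lims)
  then have "(\<lambda>n. norm (m11 (X n) - p) + norm (m12 (X n) - q) + norm (m21 (X n) - r) + norm (m22 (X n) - s))
      \<longlonglongrightarrow> 0" by simp
  then have "(\<lambda>n. dist (X n) (Mat2 p q r s)) \<longlonglongrightarrow> 0"
  proof (rule tendsto_0_le[where K = 1], intro always_eventually allI)
    fix n
    show "norm (dist (X n) (Mat2 p q r s)) \<le> norm (norm (m11 (X n) - p) + norm (m12 (X n) - q) +
        norm (m21 (X n) - r) + norm (m22 (X n) - s)) * 1"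
      using mat2_norm_le_sum[of "X n - Mat2 p q r s"] by (simp add: dist_norm minus_mat2_def)
  qed
  then have "X \<longlonglongrightarrow> Mat2 p q r s"
    by (rule tendsto_dist_iff[THEN iffD2])
  then show "convergent X" by (auto simp: convergent_def)
qed

instantiation mat2 :: (complex_banach_algebra_1) complex_banach_algebra_1
begin

definition "1 = Mat2 1 0 0 1"

definition "z *\<^sub>C x = Mat2 (z *\<^sub>C m11 x) (z *\<^sub>C m12 x) (z *\<^sub>C m21 x) (z *\<^sub>C m22 x)"

instance
proof
  fix x y :: "'a mat2" and r :: real and u v :: complex
  show "1 * x = x" "x * 1 = x"
    by (auto simp: mat2_defs one_mat2_def mat2_eq_iff)
  show "r *\<^sub>R x = complex_of_real r *\<^sub>C x" "u *\<^sub>C (x + y) = u *\<^sub>C x + u *\<^sub>C y"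
    "(u + v) *\<^sub>C x = u *\<^sub>C x + v *\<^sub>C x" "u *\<^sub>C v *\<^sub>C x = (u * v) *\<^sub>C x" "1 *\<^sub>C x = x"
    "u *\<^sub>C x * y = u *\<^sub>C (x * y)" "x * u *\<^sub>C y = u *\<^sub>C (x * y)"
    by (auto simp: mat2_defs scaleC_mat2_def mat2_eq_iff scaleR_scaleC scaleC_add_right scaleC_add_left scaleC_scaleC
        scaleC_one mult_scaleC_left mult_scaleC_right)
  show "norm (u *\<^sub>C x) = cmod u * norm x"
    by (simp add: norm_mat2_def scaleC_mat2_def norm_scaleC max_mult_distrib_left ring_distribs)
qed

end

end

(*
  Put x = bc. The hypotheses force x to commute with a and to lie in the corner of the idempotent
  a a^d. By Cline's formula (pq has a g-Drazin inverse iff qp does), M may be replaced by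
  N = [[a, 1], [x, 0]], whose entries commute and which satisfies N (a - N) = -x. If N has a
  g-Drazin inverse, so does its adjugate a - N, again by Cline's formula, and hence their product.
  Conversely, an approximate inverse of N is written down explicitly. It suffices that it commutes
  with N and that N - N^2 Y is quasinilpotent: N Y is then an idempotent up to a quasinilpotent
  error, and idempotents lift along such errors by the binomial series of (1 + v)^(-1/2).
*)

theory Submission
  imports Defs
begin

section \<open>Quasinilpotent elements\<close>

text \<open>The factor \<open>norm 1\<close> accounts for the power 0, since the norm of the
  identity may differ from 1.\<close>

lemma norm_power_le_one:
  fixes v :: "'a::complex_banach_algebra_1"
  shows "norm (v ^ n) \<le> norm (1::'a) * norm v ^ n"
proof (induction n)
  case (Suc n)
  have "norm (v ^ Suc n) \<le> norm v * norm (v ^ n)" by (simp add: norm_mult_ineq)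
  also have "\<dots> \<le> norm v * (norm (1::'a) * norm v ^ n)" by (intro mult_left_mono Suc.IH) auto
  finally show ?case by (simp add: mult_ac)
qed simp

text \<open>The limit of roots is traded for geometric bounds of arbitrarily small rate, which
  combine more easily under products and sums.\<close>

lemma quasinilpotentD:
  fixes w :: "'a::complex_banach_algebra_1"
  assumes "quasinilpotent w" "e > 0"
  obtains C where "C \<ge> 0" "\<And>n. norm (w ^ n) \<le> C * e ^ n"
proof -
  have "(\<lambda>n. (1/e) ^ n * norm (w ^ n)) \<longlonglongrightarrow> 0"
    by (rule quasinilpotent_power_norm_tendsto_0) (use assms in auto)
  then have "Bseq (\<lambda>n. (1/e) ^ n * norm (w ^ n))"
    by (intro convergent_imp_Bseq convergentI)
  then obtain C where C: "C > 0" "\<And>n. norm ((1/e) ^ n * norm (w ^ n)) \<le> C"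
    by (auto elim: BseqE)
  have "norm (w ^ n) \<le> C * e ^ n" for n
    using C(2)[of n] assms(2) by (simp add: power_divide field_simps)
  with C(1) show ?thesis by (intro that[of C]) auto
qed

text \<open>A constant factor disappears because its \<open>n\<close>-th root tends to 1; halving
  \<open>e\<close> leaves room for \<open>root n B < 2\<close>.\<close>

lemma quasinilpotentI:
  fixes w :: "'a::complex_banach_algebra_1"
  assumes "\<And>e. e > 0 \<Longrightarrow> \<exists>C. \<forall>n. norm (w ^ n) \<le> C * e ^ n"
  shows "quasinilpotent w"
  unfolding quasinilpotent_def
proof (rule tendstoI)
  fix e :: real assume e: "e > 0"
  obtain C where C: "\<And>n. norm (w ^ n) \<le> C * (e/2) ^ n"
    using assms[of "e/2"] e by auto
  \<comment> \<open>The maximum makes the constant positive, as the limit of its roots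
    requires.\<close>
  define B where "B = max C 1"
  have "(\<lambda>n. root n B) \<longlonglongrightarrow> 1"
    by (rule LIMSEQ_root_const) (simp add: B_def)
  then have "\<forall>\<^sub>F n in sequentially. root n B < 2"
    by (rule order_tendstoD(2)) simp
  with eventually_gt_at_top[of "0::nat"]
  show "\<forall>\<^sub>F n in sequentially. dist (root n (norm (w ^ n))) 0 < e"
  proof eventually_elim
    case (elim n)
    have "norm (w ^ n) \<le> B * (e/2) ^ n"
      using e by (intro order_trans[OF C[of n]] mult_right_mono) (auto simp: B_def)
    then have "root n (norm (w ^ n)) \<le> root n (B * (e/2) ^ n)"
      using elim by simp
    also have "\<dots> = root n B * (e/2)"
      using elim e by (simp add: real_root_mult real_root_power_cancel)
    also have "\<dots> < 2 * (e/2)"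
      using elim e by (intro mult_strict_right_mono) auto
    finally show ?case using elim by (simp add: real_root_ge_zero)
  qed
qed

text \<open>Commuting factors give \<open>(w * v) ^ n = w ^ n * v ^ n\<close>; a smaller rate for
  \<open>w\<close> absorbs the geometric growth of \<open>v ^ n\<close>.\<close>

lemma quasinilpotent_mult_commute:
  fixes v w :: "'a::complex_banach_algebra_1"
  assumes w: "quasinilpotent w" and vw: "w * v = v * w"
  shows "quasinilpotent (w * v)"
proof (rule quasinilpotentI)
  fix e :: real assume e: "e > 0"
  \<comment> \<open>Adding 1 keeps the rate \<open>e / r\<close> meaningful when
    \<open>v = 0\<close>.\<close>
  define r where "r = norm v + 1"
  have r: "r > 0" by (simp add: r_def add_nonneg_pos)
  obtain C where C: "C \<ge> 0" "\<And>n. norm (w ^ n) \<le> C * (e / r) ^ n"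
    using quasinilpotentD[OF w, of "e / r"] e r by auto
  have "norm ((w * v) ^ n) \<le> (C * norm (1::'a)) * e ^ n" for n
  proof -
    have "norm v ^ n \<le> r ^ n" by (intro power_mono) (auto simp: r_def)
    then have vn: "norm (v ^ n) \<le> norm (1::'a) * r ^ n"
      by (intro order_trans[OF norm_power_le_one] mult_left_mono) auto
    have "norm ((w * v) ^ n) \<le> norm (w ^ n) * norm (v ^ n)"
      unfolding commuting_power_mult[OF vw] by (rule norm_mult_ineq)
    also have "\<dots> \<le> (C * (e / r) ^ n) * (norm (1::'a) * r ^ n)"
      using C e r by (intro mult_mono C(2) vn) auto
    also have "\<dots> = (C * norm (1::'a)) * e ^ n"
      using r by (simp add: power_divide)
    finally show ?thesis .
  qed
  then show "\<exists>C. \<forall>n. norm ((w * v) ^ n) \<le> C * e ^ n" by blast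
qed

text \<open>Mixed products vanish, so every positive power of the sum is the sum of the
  powers.\<close>

lemma quasinilpotent_add_orthogonal:
  fixes v w :: "'a::complex_banach_algebra_1"
  assumes v: "quasinilpotent v" and w: "quasinilpotent w" and vw: "v * w = 0" "w * v = 0"
  shows "quasinilpotent (v + w)"
proof (rule quasinilpotentI)
  fix e :: real assume e: "e > 0"
  obtain C D where C: "\<And>n. norm (v ^ n) \<le> C * e ^ n" and D: "\<And>n. norm (w ^ n) \<le> D * e ^ n"
    using quasinilpotentD[OF v e] quasinilpotentD[OF w e] by metis
  have eq: "(v + w) ^ Suc n = v ^ Suc n + w ^ Suc n" for n
  proof (induction n)
    case (Suc n)
    have "(v + w) ^ Suc (Suc n) = (v + w) * (v ^ Suc n + w ^ Suc n)"
      by (subst Suc.IH[symmetric]) simp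
    also have "\<dots> = v ^ Suc (Suc n) + w ^ Suc (Suc n) + (v * w) * w ^ n + (w * v) * v ^ n"
      by (simp add: distrib_left distrib_right mult.assoc)
    finally show ?case by (simp add: vw)
  qed simp
  have "norm ((v + w) ^ n) \<le> norm (v ^ n) + norm (w ^ n)" for n
    by (cases n) (simp, metis eq norm_triangle_ineq)
  also have "norm (v ^ n) + norm (w ^ n) \<le> (C + D) * e ^ n" for n
    using C[of n] D[of n] by (simp add: distrib_right)
  finally have "norm ((v + w) ^ n) \<le> (C + D) * e ^ n" for n .
  then show "\<exists>C. \<forall>n. norm ((v + w) ^ n) \<le> C * e ^ n" by blast
qed

text \<open>A lag of one power costs only a factor \<open>1 / e\<close> in the constant.\<close>

lemma quasinilpotent_if_norm_power_Suc_le: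
  fixes v :: "'a::complex_banach_algebra_1" and w :: "'b::complex_banach_algebra_1"
  assumes v: "quasinilpotent v" and K: "K \<ge> 0"
    and le: "\<And>n. norm (w ^ Suc n) \<le> K * norm (v ^ n)"
  shows "quasinilpotent w"
proof (rule quasinilpotentI)
  fix e :: real assume e: "e > 0"
  obtain C where C: "C \<ge> 0" "\<And>n. norm (v ^ n) \<le> C * e ^ n"
    using quasinilpotentD[OF v e] by metis
  have "norm (w ^ n) \<le> (norm (1::'b) + K * C / e) * e ^ n" for n
  proof (cases n)
    case 0
    then show ?thesis using K C e by simp
  next
    case (Suc m)
    have "norm (w ^ n) \<le> K * (C * e ^ m)"
      using le[of m] mult_left_mono[OF C(2)[of m] K] Suc by simp
    also have "\<dots> = (K * C / e) * e ^ n"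
      using e Suc by simp
    also have "\<dots> \<le> (norm (1::'b) + K * C / e) * e ^ n"
      using e by (intro mult_right_mono) auto
    finally show ?thesis .
  qed
  then show "\<exists>C. \<forall>n. norm (w ^ n) \<le> C * e ^ n" by blast
qed

lemma power_Suc_mult_swap:
  fixes v w :: "'a::monoid_mult"
  shows "(w * v) ^ Suc n = w * (v * w) ^ n * v"
proof (induction n)
  case (Suc n)
  have "(w * v) ^ Suc (Suc n) = (w * v) * (w * (v * w) ^ n * v)"
    by (subst Suc.IH[symmetric]) simp
  then show ?case by (simp add: mult.assoc)
qed simp

lemma quasinilpotent_mult_swap:
  fixes v w :: "'a::complex_banach_algebra_1"
  assumes "quasinilpotent (v * w)"
  shows "quasinilpotent (w * v)"
proof (rule quasinilpotent_if_norm_power_Suc_le[OF assms])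
  fix n
  have "norm ((w * v) ^ Suc n) \<le> norm w * norm ((v * w) ^ n) * norm v"
    unfolding power_Suc_mult_swap
    by (intro order_trans[OF norm_mult_ineq] mult_right_mono norm_mult_ineq norm_ge_zero)
  then show "norm ((w * v) ^ Suc n) \<le> (norm w * norm v) * norm ((v * w) ^ n)"
    by (simp only: mult_ac)
qed simp

text \<open>Iterating the hypothesis gives \<open>w ^ Suc n = w * v ^ n\<close>. It serves for a
  matrix with zero lower row, with \<open>v\<close> diagonal.\<close>

lemma quasinilpotent_if_square_eq:
  fixes v w :: "'a::complex_banach_algebra_1"
  assumes v: "quasinilpotent v" and ww: "w * w = w * v"
  shows "quasinilpotent w"
proof (rule quasinilpotent_if_norm_power_Suc_le[OF v])
  fix n
  have "w ^ Suc n = w * v ^ n"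
  proof (induction n)
    case (Suc n)
    have "w ^ Suc (Suc n) = (w * w) * v ^ n"
      using Suc.IH by (simp add: mult.assoc)
    then show ?case by (simp add: ww mult.assoc)
  qed simp
  then show "norm (w ^ Suc n) \<le> norm w * norm (v ^ n)"
    by (simp only: norm_mult_ineq)
qed simp

lemma quasinilpotent_scaleR:
  fixes w :: "'a::complex_banach_algebra_1"
  assumes "quasinilpotent w"
  shows "quasinilpotent (r *\<^sub>R w)"
  using quasinilpotent_mult_commute[OF assms, of "r *\<^sub>R 1"] by simp


section \<open>The inverse square root of a quasinilpotent perturbation of 1\<close>

text \<open>Consecutive coefficients have ratio \<open>(- 1 / 2 - n) / (n + 1)\<close>, of absolute
  value at most 1. Bounded coefficients suffice for convergence at a quasinilpotent element.\<close>

lemma abs_gbinomial_minus_half_le: "\<bar>(- 1 / 2 :: real) gchoose n\<bar> \<le> 1"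
proof (induction n)
  case (Suc n)
  have "(- 1 / 2 :: real) gchoose Suc n = ((- 1 / 2 - real n) / real (Suc n)) * ((- 1 / 2) gchoose n)"
    using gbinomial_mult_1[of "- 1 / 2 :: real" n] by (simp add: field_simps)
  also have "\<bar>\<dots>\<bar> \<le> 1 * 1"
    unfolding abs_mult by (intro mult_mono Suc.IH) (auto simp: field_simps)
  finally show ?case by simp
qed simp

lemma gbinomial_minus_one: "(- 1 :: real) gchoose n = (- 1) ^ n"
  using gbinomial_minus[of "1::real" n] by (simp add: binomial_gbinomial[symmetric])

lemma summable_quasinilpotent_series:
  fixes w :: "'a::complex_banach_algebra_1"
  assumes w: "quasinilpotent w" and c: "\<And>n. \<bar>c n\<bar> \<le> (1::real)"
  shows "summable (\<lambda>n. norm (c n *\<^sub>R w ^ n))"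
proof -
  obtain C where C: "C \<ge> 0" "\<And>n. norm (w ^ n) \<le> C * (1/2) ^ n"
    using quasinilpotentD[OF w, of "1/2"] by auto
  show ?thesis
  proof (rule summable_comparison_test')
    show "summable (\<lambda>n. C * (1/2) ^ n)"
      by (intro summable_mult summable_geometric) simp
    show "norm (norm (c n *\<^sub>R w ^ n)) \<le> C * (1/2) ^ n" if "n \<ge> 0" for n
      using mult_mono[OF c[of n] C(2)[of n]] C(1) by simp
  qed
qed

lemma commute_quasinilpotent_series:
  fixes w z :: "'a::complex_banach_algebra_1"
  assumes w: "quasinilpotent w" and c: "\<And>n. \<bar>c n\<bar> \<le> (1::real)" and z: "w * z = z * w"
  shows "(\<Sum>n. c n *\<^sub>R w ^ n) * z = z * (\<Sum>n. c n *\<^sub>R w ^ n)"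
proof -
  have s: "summable (\<lambda>n. c n *\<^sub>R w ^ n)"
    by (rule summable_norm_cancel, rule summable_quasinilpotent_series[OF w]) (rule c)
  have "w ^ n * z = z * w ^ n" for n
    using power_commuting_commutes[of w z n] z by simp
  then show ?thesis
    by (simp add: suminf_mult[OF s, symmetric] suminf_mult2[OF s])
qed

text \<open>\<open>1 + w * h\<close> is the binomial series of the inverse square root of
  \<open>1 + w\<close>. Splitting off the factor \<open>w\<close> shows that it differs from 1 by a
  multiple of \<open>w\<close>.\<close>

lemma quasinilpotent_inverse_sqrt:
  fixes w :: "'a::complex_banach_algebra_1"
  assumes w: "quasinilpotent w"
  obtains h where "(1 + w * h) * (1 + w * h) * (1 + w) = 1"
    and "\<And>z. w * z = z * w \<Longrightarrow> h * z = z * h"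
proof -
  define c where "c n = (- 1 / 2 :: real) gchoose n" for n
  have c: "\<bar>c n\<bar> \<le> 1" for n
    unfolding c_def by (rule abs_gbinomial_minus_half_le)
  define R where "R = (\<Sum>n. c n *\<^sub>R w ^ n)"
  define h where "h = (\<Sum>n. c (Suc n) *\<^sub>R w ^ n)"
  define S where "S = (\<Sum>n. (- 1 :: real) ^ n *\<^sub>R w ^ n)"
  have sR: "summable (\<lambda>n. norm (c n *\<^sub>R w ^ n))"
    by (intro summable_quasinilpotent_series w c)
  have sh: "summable (\<lambda>n. c (Suc n) *\<^sub>R w ^ n)"
    by (rule summable_norm_cancel, rule summable_quasinilpotent_series[OF w]) (rule c)
  have sS: "summable (\<lambda>n. (- 1 :: real) ^ n *\<^sub>R w ^ n)"
    by (rule summable_norm_cancel, rule summable_quasinilpotent_series[OF w]) simp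
  have R: "R = 1 + w * h"
    using suminf_split_head[OF summable_norm_cancel[OF sR]] suminf_mult[OF sh, of w]
    by (simp add: R_def h_def c_def diff_eq_eq add.commute)
  \<comment> \<open>By Vandermonde's convolution, squaring the series doubles the exponent from -1/2
    to -1.\<close>
  have "(\<Sum>i\<le>n. (c i *\<^sub>R w ^ i) * (c (n - i) *\<^sub>R w ^ (n - i))) = (- 1) ^ n *\<^sub>R w ^ n" for n
  proof -
    have "(\<Sum>i\<le>n. (c i *\<^sub>R w ^ i) * (c (n - i) *\<^sub>R w ^ (n - i))) = (\<Sum>i\<le>n. (c i * c (n - i)) *\<^sub>R w ^ n)"
      by (intro sum.cong refl) (simp add: power_add[symmetric] mult.commute)
    also have "\<dots> = ((- 1 / 2 + - 1 / 2) gchoose n) *\<^sub>R w ^ n"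
      by (simp only: scaleR_left.sum[symmetric] c_def gbinomial_Vandermonde atMost_atLeast0)
    finally show ?thesis by (simp add: gbinomial_minus_one)
  qed
  then have RS: "R * R = S"
    using Cauchy_product[OF sR sR] by (simp add: R_def S_def)
  have "S = 1 - S * w"
    using suminf_split_head[OF sS] suminf_mult2[OF sS, of w] suminf_minus[OF summable_mult2[OF sS, of w]]
    by (simp add: S_def power_commutes diff_eq_eq)
  then have "S * (1 + w) = 1" by (simp add: distrib_left eq_diff_eq)
  then have "(1 + w * h) * (1 + w * h) * (1 + w) = 1" using RS R by simp
  moreover have "h * z = z * h" if "w * z = z * w" for z
    unfolding h_def by (intro commute_quasinilpotent_series w c that)
  ultimately show ?thesis by (rule that)
qed


section \<open>Existence criteria for the generalized Drazin inverse\<close>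

text \<open>In products nested to the right, a commutation rule must also act in front of a
  remaining factor \<open>z\<close>.\<close>

lemma left_commute_if_commute:
  fixes a b z :: "'a::semigroup_mult"
  shows "a * b = b * a \<Longrightarrow> a * (b * z) = b * (a * z)"
  by (metis mult.assoc)

lemma mult_eq_imp_mult_left_eq:
  fixes a b c d z :: "'a::semigroup_mult"
  shows "a * (b * c) = d \<Longrightarrow> a * (b * (c * z)) = d * z"
  by (metis mult.assoc)

text \<open>With \<open>q = 1 - x * y\<close>, the corner \<open>x * y * z * q\<close> equals
  \<open>y ^ n * z * (x * q) ^ n\<close> for all \<open>n > 0\<close>, and this tends to 0 since
  \<open>x * q\<close> is quasinilpotent. The opposite corner vanishes likewise, so \<open>z\<close>
  commutes with the idempotent \<open>x * y\<close>, and then with \<open>y\<close>.\<close>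

lemma gdrazin_inverse_double_commute:
  fixes x y z :: "'a::complex_banach_algebra_1"
  assumes y: "is_gdrazin_inverse x y" and z: "x * z = z * x"
  shows "y * z = z * y"
proof -
  define q where "q = 1 - x * y"
  have xy: "x * y = y * x" and yy: "y = y * x * y" and w: "quasinilpotent (x - x\<^sup>2 * y)"
    using y by (simp_all add: is_gdrazin_inverse_def)
  have ee: "(x * y) * (x * y) = x * y" using yy by (metis mult.assoc)
  have wq: "x - x\<^sup>2 * y = x * q" by (simp add: q_def right_diff_distrib power2_eq_square mult.assoc)
  have xq: "x * q = q * x"
    using xy by (simp add: q_def left_diff_distrib right_diff_distrib mult.assoc)
      (metis mult.assoc)
  have qq: "q * q = q" using ee by (simp add: q_def left_diff_distrib right_diff_distrib)
  have zn: "x ^ n * z = z * x ^ n" for n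
    using power_commuting_commutes[of x z n] z by simp
  have wn: "(x * q) ^ n = x ^ n * q" "x ^ n * q = q * x ^ n"
    and en: "x * y = y ^ n * x ^ n" "x * y = x ^ n * y ^ n" if "n > 0" for n
    using commuting_power_mult[OF xq, of n] idempotent_power[OF qq that] xq
      power_commuting_commutes[of x q n] commuting_power_mult[OF xy, of n]
      commuting_power_mult[OF xy[symmetric], of n] idempotent_power[OF ee that] xy
    by simp_all
  have vanish: "u = 0"
    if "\<And>n. n > 0 \<Longrightarrow> norm u \<le> (norm y ^ n * norm ((x * q) ^ n)) * norm z" for u :: 'a
  proof -
    have "(\<lambda>n. (norm y ^ n * norm ((x * q) ^ n)) * norm z) \<longlonglongrightarrow> 0 * norm z"
      using w unfolding wq by (intro tendsto_intros quasinilpotent_power_norm_tendsto_0) auto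
    then have "norm u \<le> 0 * norm z"
      using eventually_mono[OF eventually_gt_at_top[of "0::nat"] that]
      by (intro tendsto_lowerbound) auto
    then show ?thesis by simp
  qed
  have "x * y * z * q = 0"
  proof (rule vanish)
    fix n :: nat assume n: "n > 0"
    have "x * y * z * q = y ^ n * z * (x * q) ^ n"
      using en(1)[OF n] wn[OF n] zn[of n] by (metis mult.assoc)
    also have "norm \<dots> \<le> norm (y ^ n) * norm z * norm ((x * q) ^ n)"
      by (intro order_trans[OF norm_mult_ineq] mult_right_mono norm_mult_ineq norm_ge_zero)
    also have "\<dots> \<le> norm y ^ n * norm z * norm ((x * q) ^ n)"
      by (intro mult_right_mono norm_power_le_power_norm n norm_ge_zero)
    finally show "norm (x * y * z * q) \<le> (norm y ^ n * norm ((x * q) ^ n)) * norm z"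
      by (simp only: mult_ac)
  qed
  moreover have "q * z * (x * y) = 0"
  proof (rule vanish)
    fix n :: nat assume n: "n > 0"
    have "q * z * (x * y) = (x * q) ^ n * z * y ^ n"
      using en(2)[OF n] wn[OF n] zn[of n] by (metis mult.assoc)
    also have "norm \<dots> \<le> norm ((x * q) ^ n) * norm z * norm (y ^ n)"
      by (intro order_trans[OF norm_mult_ineq] mult_right_mono norm_mult_ineq norm_ge_zero)
    also have "\<dots> \<le> norm ((x * q) ^ n) * norm z * norm y ^ n"
      by (intro mult_left_mono norm_power_le_power_norm n) auto
    finally show "norm (q * z * (x * y)) \<le> (norm y ^ n * norm ((x * q) ^ n)) * norm z"
      by (simp only: mult_ac)
  qed
  ultimately have "x * y * z = x * y * z * (x * y)" "z * (x * y) = x * y * z * (x * y)"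
    by (simp_all add: q_def left_diff_distrib right_diff_distrib)
  then have ez: "x * y * z = z * (x * y)" by (rule trans[OF _ sym])
  have "y * z = y * (x * y * z)" using yy by (metis mult.assoc)
  also have "\<dots> = y * z * x * y" unfolding ez by (simp add: mult.assoc)
  also have "\<dots> = x * y * z * y" using z xy by (metis mult.assoc)
  also have "\<dots> = z * y" using ez yy xy by (metis mult.assoc)
  finally show ?thesis .
qed

text \<open>
  The element \<open>x * y\<close> is only an idempotent up to a quasinilpotent error; the inverse square
  root turns it into the idempotent \<open>e = (1 + (2 x y - 1) / sqrt (1 + v)) / 2\<close>, where
  \<open>(2 x y - 1)\<^sup>2 = 1 + v\<close>.
\<close>

lemma has_gdrazin_inverseI:
  fixes x y :: "'a::complex_banach_algebra_1"
  assumes xy: "x * y = y * x" and w: "quasinilpotent (x - x\<^sup>2 * y)"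
  shows "has_gdrazin_inverse x"
proof -
  define t where "t = x - x\<^sup>2 * y"
  define g where "g = x * y"
  define s where "s = g + g - 1"
  \<comment> \<open>Since \<open>g - g * g = t * y\<close>, this is the deviation of
    \<open>s * s\<close> from 1.\<close>
  define v where "v = (- 4) *\<^sub>R (t * y)"
  note yx = xy[symmetric] left_commute_if_commute[OF xy[symmetric]]
  have tx: "t * x = x * t" and ty: "t * y = y * t"
    by (simp_all add: t_def algebra_simps power2_eq_square yx)
  have t: "quasinilpotent t" using w by (simp add: t_def)
  have v: "quasinilpotent v"
    unfolding v_def by (intro quasinilpotent_scaleR quasinilpotent_mult_commute t ty)
  note txy = tx left_commute_if_commute[OF tx] ty left_commute_if_commute[OF ty]
  obtain h where h: "(1 + v * h) * (1 + v * h) * (1 + v) = 1"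
    and hc: "\<And>z. v * z = z * v \<Longrightarrow> h * z = z * h"
    using quasinilpotent_inverse_sqrt[OF v] by blast
  have hx: "h * x = x * h" and hy: "h * y = y * h" and ht: "h * t = t * h"
    by (rule hc, simp add: v_def mult.assoc txy yx)+
  note comm = yx txy hx left_commute_if_commute[OF hx] hy left_commute_if_commute[OF hy]
    ht left_commute_if_commute[OF ht]
  have xxy: "x * (x * y) = x - t"
    by (simp add: t_def power2_eq_square mult.assoc)
  note xxyz = xxy[THEN mult_eq_imp_mult_left_eq]
  have four: "4 *\<^sub>R u = u + u + (u + u)" for u :: 'a
    using scaleR_left_distrib[of 2 2 u] by (simp add: scaleR_2)
  have ss: "s * s = 1 + v"
    by (simp add: s_def g_def v_def four algebra_simps comm xxyz)
  \<comment> \<open>Chosen so that \<open>t * m\<close> is the difference between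
    \<open>(1 + S) / 2\<close>, with \<open>S = s * (1 + v * h)\<close>, and
    \<open>g = (1 + s) / 2\<close>.\<close>
  define m where "m = (- 2) *\<^sub>R (s * (y * h))"
  define e where "e = g + t * m"
  have mt: "t * m = m * t" and mx: "m * x = x * m" and my: "m * y = y * m"
    and gx: "g * x = x * g" and gy: "g * y = y * g" and gm: "g * m = m * g" and gt: "g * t = t * g"
    by (simp_all add: m_def s_def g_def algebra_simps comm)
  have ex: "e * x = x * e" and ey: "e * y = y * e" and etm: "t * m * e = e * (t * m)"
    using mt mx my gx gy gm gt tx ty
    by (simp_all add: e_def distrib_left distrib_right, (metis mult.assoc)+)
  \<comment> \<open>\<open>S\<close> is an involution, so \<open>(1 + S) / 2\<close> is
    idempotent.\<close>
  have ee: "e * e = e"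
  proof -
    define S where "S = s * (1 + v * h)"
    have "(1 + v * h) * s = s * (1 + v * h)"
      by (simp add: s_def g_def v_def algebra_simps comm)
    then have "S * S = (s * s) * ((1 + v * h) * (1 + v * h))"
      unfolding S_def by (metis mult.assoc)
    also have "\<dots> = (1 + v * h) * (1 + v * h) * (1 + v)"
      unfolding ss by (simp add: v_def algebra_simps comm)
    finally have SS: "S * S = 1" using h by simp
    have "e = (1/2) *\<^sub>R (1 + S)"
      by (simp add: e_def S_def m_def s_def v_def g_def algebra_simps comm scaleR_2[symmetric])
    moreover have "(1 + S) * (1 + S) = 2 *\<^sub>R (1 + S)"
      by (simp add: distrib_left distrib_right SS scaleR_2)
    ultimately show ?thesis by simp
  qed
  have tm: "quasinilpotent (- (t * m))"
    using quasinilpotent_scaleR[OF quasinilpotent_mult_commute[OF t mt], of "- 1"] by simp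
  \<comment> \<open>The square of the inverse square root is the inverse \<open>k\<close> of
    \<open>1 - t * m\<close>, and it inherits the commutation property.\<close>
  obtain j where j: "(1 + - (t * m) * j) * (1 + - (t * m) * j) * (1 + - (t * m)) = 1"
    and jc: "\<And>z. - (t * m) * z = z * - (t * m) \<Longrightarrow> j * z = z * j"
    using quasinilpotent_inverse_sqrt[OF tm] by blast
  define k where "k = (1 + - (t * m) * j) * (1 + - (t * m) * j)"
  have kc: "k * z = z * k" if z: "t * m * z = z * (t * m)" for z
  proof -
    have "j * z = z * j" using z by (intro jc) simp
    then have A: "(1 + - (t * m) * j) * z = z * (1 + - (t * m) * j)"
      using z by (simp add: algebra_simps) (metis mult.assoc)
    show ?thesis
      by (simp only: k_def mult.assoc A left_commute_if_commute[OF A])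
  qed
  have tmx: "t * m * x = x * (t * m)" using tx mx by (metis mult.assoc)
  have "k * (1 - t * m) = 1"
    using j by (simp add: k_def)
  moreover have "k * (1 - t * m) = (1 - t * m) * k"
    by (rule kc) (simp add: left_diff_distrib right_diff_distrib)
  ultimately have k: "(1 - t * m) * k = 1" by simp
  \<comment> \<open>On the range of \<open>e\<close>, \<open>x * y\<close> acts as
    \<open>1 - t * m\<close>; the factor \<open>k\<close> corrects \<open>y\<close> to an exact
    inverse of \<open>x\<close> there.\<close>
  define d where "d = y * (e * k)"
  have ge: "g * e = e * (1 - t * m)"
    using ee etm by (simp add: e_def algebra_simps)
  have xd: "x * d = e"
    using ge k unfolding d_def g_def by (metis mult.assoc mult_1_right)
  have kx: "k * x = x * k" and ke: "k * e = e * k"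
    using tmx etm by (auto intro: kc)
  have "d * x = x * d"
    by (simp only: d_def mult.assoc kx left_commute_if_commute[OF ex] yx)
  with xd have dx: "d * x = e" by simp
  have "e * (e * k) = e * k" by (simp add: mult.assoc[symmetric] ee)
  then have "d * x * d = d"
    unfolding dx by (simp only: d_def left_commute_if_commute[OF ey])
  moreover have "x - x\<^sup>2 * d = t * (1 - x * m)"
    by (simp add: power2_eq_square mult.assoc xd)
      (simp add: e_def g_def distrib_left right_diff_distrib xxy left_commute_if_commute[OF tx])
  moreover have "quasinilpotent (t * (1 - x * m))"
    by (intro quasinilpotent_mult_commute t)
      (simp add: left_diff_distrib right_diff_distrib mult.assoc mt[symmetric] left_commute_if_commute[OF tx])
  ultimately show ?thesis
    unfolding has_gdrazin_inverse_def is_gdrazin_inverse_def using xd dx by (intro exI[of _ d]) simp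
qed

text \<open>Cline's formula: the inverse is \<open>q * d * d * p\<close>. Its defect
  \<open>q * ((1 - p * q * d) * p)\<close> becomes the defect of \<open>d\<close> after a cyclic
  permutation, which preserves quasinilpotency.\<close>

lemma has_gdrazin_inverse_mult_swap:
  fixes p q :: "'a::complex_banach_algebra_1"
  assumes "has_gdrazin_inverse (p * q)"
  shows "has_gdrazin_inverse (q * p)"
proof -
  obtain d where d: "p * q * d = d * (p * q)" "d = d * (p * q) * d"
    "quasinilpotent (p * q - (p * q)\<^sup>2 * d)"
    using assms by (auto simp: has_gdrazin_inverse_def is_gdrazin_inverse_def)
  have l: "q * p * (q * d * d * p) = q * d * p"
    using d(1,2) by (metis mult.assoc)
  have r: "q * d * d * p * (q * p) = q * d * p"
    using d(1,2) by (metis mult.assoc)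
  have "(1 - p * q * d) * p * q = p * q - (p * q)\<^sup>2 * d"
    using d(1) by (simp add: power2_eq_square left_diff_distrib) (metis mult.assoc)
  then have "quasinilpotent (q * ((1 - p * q * d) * p))"
    using d(3) by (intro quasinilpotent_mult_swap[of "(1 - p * q * d) * p"]) simp
  also have "q * ((1 - p * q * d) * p) = q * p - (q * p)\<^sup>2 * (q * d * d * p)"
    unfolding power2_eq_square mult.assoc[of "q * p" "q * p"] l
    by (simp add: left_diff_distrib right_diff_distrib mult.assoc)
  finally show ?thesis
    by (intro has_gdrazin_inverseI[of _ "q * d * d * p"]) (simp_all add: l r)
qed

text \<open>By double commutation all four elements commute. The defect of \<open>x' * z'\<close>
  splits into a multiple of \<open>v\<close>, under the idempotent \<open>1 - x * x'\<close>, and a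
  multiple of \<open>w\<close>, under \<open>x * x'\<close>; these are orthogonal.\<close>

lemma has_gdrazin_inverse_mult_commute:
  fixes x z :: "'a::complex_banach_algebra_1"
  assumes x: "has_gdrazin_inverse x" and z: "has_gdrazin_inverse z" and xz: "x * z = z * x"
  shows "has_gdrazin_inverse (x * z)"
proof -
  obtain x' z' where x': "is_gdrazin_inverse x x'" and z': "is_gdrazin_inverse z z'"
    using x z by (auto simp: has_gdrazin_inverse_def)
  have c1: "x' * z = z * x'" using gdrazin_inverse_double_commute[OF x' xz] .
  have c2: "z' * x = x * z'" using gdrazin_inverse_double_commute[OF z' xz[symmetric]] .
  have c3: "x' * z' = z' * x'"
    using gdrazin_inverse_double_commute[OF x' c2[symmetric]] .
  have xx': "x * x' = x' * x" "x' = x' * x * x'" "quasinilpotent (x - x\<^sup>2 * x')"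
    and zz': "z * z' = z' * z" "z' = z' * z * z'" "quasinilpotent (z - z\<^sup>2 * z')"
    using x' z' by (auto simp: is_gdrazin_inverse_def)
  note comm = xx'(1)[symmetric] left_commute_if_commute[OF xx'(1)[symmetric]]
    zz'(1)[symmetric] left_commute_if_commute[OF zz'(1)[symmetric]]
    xz[symmetric] left_commute_if_commute[OF xz[symmetric]]
    c1[symmetric] left_commute_if_commute[OF c1[symmetric]]
    c2 left_commute_if_commute[OF c2] c3[symmetric] left_commute_if_commute[OF c3[symmetric]]
  have "x * (x' * x') = x'"
    using xx'(1,2) by (metis mult.assoc)
  note absorb = this[THEN mult_eq_imp_mult_left_eq]
  define v where "v = x - x\<^sup>2 * x'"
  define w where "w = z - z\<^sup>2 * z'"
  have "quasinilpotent (v * z + w * (x * x * x'))"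
  proof (rule quasinilpotent_add_orthogonal)
    show "quasinilpotent (v * z)"
      using xx'(3) unfolding v_def
      by (rule quasinilpotent_mult_commute) (simp add: algebra_simps power2_eq_square comm)
    show "quasinilpotent (w * (x * x * x'))"
      using zz'(3) unfolding w_def
      by (rule quasinilpotent_mult_commute) (simp add: algebra_simps power2_eq_square comm)
    show "v * z * (w * (x * x * x')) = 0" "w * (x * x * x') * (v * z) = 0"
      by (simp_all add: v_def w_def algebra_simps power2_eq_square comm absorb)
  qed
  also have "v * z + w * (x * x * x') = x * z - (x * z)\<^sup>2 * (x' * z')"
    by (simp add: v_def w_def algebra_simps power2_eq_square comm)
  finally show ?thesis
    by (rule has_gdrazin_inverseI[rotated]) (simp add: mult.assoc comm)
qed

section \<open>Diagonal matrices with equal entries\<close>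

lemma mat2_mult: "Mat2 a b c d * Mat2 a' b' c' d' =
    Mat2 (a * a' + b * c') (a * b' + b * d') (c * a' + d * c') (c * b' + d * d')"
  by (simp add: times_mat2_def)

lemma mat2_diag_power:
  fixes a b :: "'a::complex_banach_algebra_1"
  shows "Mat2 a 0 0 b ^ n = Mat2 (a ^ n) 0 0 (b ^ n)"
  by (induction n) (simp_all add: mat2_mult one_mat2_def)

lemma quasinilpotent_mat2_diag:
  fixes a :: "'a::complex_banach_algebra_1"
  shows "quasinilpotent (Mat2 a 0 0 a) \<longleftrightarrow> quasinilpotent a"
  by (simp add: quasinilpotent_def mat2_diag_power norm_mat2_def)

text \<open>For the converse, a matrix with equal diagonal entries commutes with the matrix units,
  hence so does its inverse; this forces the form \<open>Mat2 p 0 0 p\<close>.\<close>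

lemma has_gdrazin_inverse_mat2_diag:
  fixes x :: "'a::complex_banach_algebra_1"
  shows "has_gdrazin_inverse (Mat2 x 0 0 x) \<longleftrightarrow> has_gdrazin_inverse x"
proof
  assume "has_gdrazin_inverse x"
  then obtain y where "x * y = y * x" "y = y * x * y" "quasinilpotent (x - x\<^sup>2 * y)"
    by (auto simp: has_gdrazin_inverse_def is_gdrazin_inverse_def)
  then show "has_gdrazin_inverse (Mat2 x 0 0 x)"
    by (intro has_gdrazin_inverseI[of _ "Mat2 y 0 0 y"])
      (simp_all add: mat2_mult minus_mat2_def power2_eq_square quasinilpotent_mat2_diag)
next
  assume "has_gdrazin_inverse (Mat2 x 0 0 x)"
  then obtain Y where Y: "is_gdrazin_inverse (Mat2 x 0 0 x) Y"
    by (auto simp: has_gdrazin_inverse_def)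
  obtain p q r s where Ypq: "Y = Mat2 p q r s" by (cases Y)
  have "Y * Mat2 0 1 0 0 = Mat2 0 1 0 0 * Y"
    by (intro gdrazin_inverse_double_commute[OF Y]) (simp add: mat2_mult)
  moreover have "Y * Mat2 0 0 1 0 = Mat2 0 0 1 0 * Y"
    by (intro gdrazin_inverse_double_commute[OF Y]) (simp add: mat2_mult)
  ultimately have "Y = Mat2 p 0 0 p" by (simp add: Ypq mat2_mult)
  then have "x * p = p * x" "quasinilpotent (x - x\<^sup>2 * p)"
    using Y by (simp_all add: is_gdrazin_inverse_def mat2_mult minus_mat2_def power2_eq_square
        quasinilpotent_mat2_diag)
  then show "has_gdrazin_inverse x" by (rule has_gdrazin_inverseI)
qed


section \<open>The companion matrix\<close>

text \<open>Moving the factor \<open>Mat2 1 0 0 b\<close> across by Cline's formula trades the pair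
  \<open>b\<close>, \<open>c\<close> for \<open>1\<close>, \<open>b * c\<close>.\<close>

lemma has_gdrazin_inverse_mat2_companion_iff:
  fixes a b c :: "'a::complex_banach_algebra_1"
  shows "has_gdrazin_inverse (Mat2 a b c 0) \<longleftrightarrow> has_gdrazin_inverse (Mat2 a 1 (b * c) 0)"
proof -
  have "Mat2 a b c 0 = Mat2 a 1 c 0 * Mat2 1 0 0 b" "Mat2 a 1 (b * c) 0 = Mat2 1 0 0 b * Mat2 a 1 c 0"
    by (simp_all add: mat2_mult)
  then show ?thesis by (metis has_gdrazin_inverse_mult_swap)
qed

text \<open>
  With \<open>N = Mat2 a 1 x 0\<close>, the adjugate \<open>a - N = Mat2 0 (- 1) (- x) a\<close> satisfies \<open>N (a - N) = - x\<close>.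
  It is conjugate to \<open>Mat2 a 1 1 0 * Mat2 1 0 0 x\<close>, whose factors multiply to \<open>N\<close> in the other order.
\<close>

lemma has_gdrazin_inverse_if_companion:
  fixes a x :: "'a::complex_banach_algebra_1"
  assumes N: "has_gdrazin_inverse (Mat2 a 1 x 0)" and ax: "a * x = x * a"
  shows "has_gdrazin_inverse x"
proof -
  have "has_gdrazin_inverse (Mat2 1 0 0 x * Mat2 a 1 1 0)"
    using N by (simp add: mat2_mult)
  then have "has_gdrazin_inverse (Mat2 a 1 1 0 * Mat2 1 0 0 x)"
    by (rule has_gdrazin_inverse_mult_swap)
  \<comment> \<open>The matrices \<open>Mat2 0 1 (- 1) 0\<close> and \<open>Mat2 0 (- 1) 1 0\<close>
    are mutually inverse, so the next swap cancels them.\<close>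
  also have "Mat2 a 1 1 0 * Mat2 1 0 0 x = Mat2 0 1 (- 1) 0 * (Mat2 0 (- 1) (- x) a * Mat2 0 (- 1) 1 0)"
    by (simp add: mat2_mult)
  finally have "has_gdrazin_inverse (Mat2 0 (- 1) (- x) a * Mat2 0 (- 1) 1 0 * Mat2 0 1 (- 1) 0)"
    by (rule has_gdrazin_inverse_mult_swap)
  then have "has_gdrazin_inverse (Mat2 0 (- 1) (- x) a)"
    by (simp add: mat2_mult)
  with N have "has_gdrazin_inverse (Mat2 a 1 x 0 * Mat2 0 (- 1) (- x) a)"
    by (rule has_gdrazin_inverse_mult_commute) (simp add: mat2_mult ax)
  then have "has_gdrazin_inverse (- x)"
    by (simp add: mat2_mult has_gdrazin_inverse_mat2_diag)
  then obtain y where "- x * y = y * - x" "quasinilpotent (- x - (- x)\<^sup>2 * y)"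
    by (auto simp: has_gdrazin_inverse_def is_gdrazin_inverse_def)
  moreover have "x - x\<^sup>2 * - y = (- 1) *\<^sub>R (- x - (- x)\<^sup>2 * y)"
    by (simp add: power2_eq_square)
  ultimately show ?thesis
    by (intro has_gdrazin_inverseI[of x "- y"]) (simp_all only: quasinilpotent_scaleR, simp)
qed

text \<open>By \<open>xp\<close>, 1 is the sum of the orthogonal idempotents \<open>x * z\<close>,
  \<open>a * y - x * z\<close> and \<open>1 - a * y\<close>; each range is treated
  separately.\<close>

lemma has_gdrazin_inverse_companion_if:
  fixes a x :: "'a::complex_banach_algebra_1"
  assumes y: "is_gdrazin_inverse a y" and x: "is_gdrazin_inverse x z"
    and ax: "a * x = x * a" and xp: "x * (a * y) = x"
  shows "has_gdrazin_inverse (Mat2 a 1 x 0)"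
proof -
  have ay: "a * y = y * a" and yy: "y = y * a * y" and qa: "quasinilpotent (a - a\<^sup>2 * y)"
    and xz: "x * z = z * x" and zz: "z = z * x * z" and qx: "quasinilpotent (x - x\<^sup>2 * z)"
    using x y by (simp_all add: is_gdrazin_inverse_def)
  have yx: "y * x = x * y" using gdrazin_inverse_double_commute[OF y ax] .
  have za: "z * a = a * z" using gdrazin_inverse_double_commute[OF x ax[symmetric]] .
  have zy: "z * y = y * z" using gdrazin_inverse_double_commute[OF x yx[symmetric]] .
  note comm = ay[symmetric] left_commute_if_commute[OF ay[symmetric]]
    ax[symmetric] left_commute_if_commute[OF ax[symmetric]]
    yx[symmetric] left_commute_if_commute[OF yx[symmetric]]
    za left_commute_if_commute[OF za] zy left_commute_if_commute[OF zy]
    xz[symmetric] left_commute_if_commute[OF xz[symmetric]]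
  have r1: "a * (y * y) = y" using yy ay by (metis mult.assoc)
  have r2: "x * (z * z) = z" using zz xz by (metis mult.assoc)
  have r3: "a * (y * x) = x" using xp by (simp add: comm)
  have r4: "a * (y * z) = z" using r2 r3 by (metis mult.assoc)
  note absorb = r1 r2 r3 r4 r1[THEN mult_eq_imp_mult_left_eq] r2[THEN mult_eq_imp_mult_left_eq]
    r3[THEN mult_eq_imp_mult_left_eq] r4[THEN mult_eq_imp_mult_left_eq]
  define N where "N = Mat2 a 1 x 0"
  txt \<open>
    Since \<open>N (N - a) = x\<close>, the inverse of \<open>N\<close> on the range of \<open>x z\<close> is \<open>z (N - a)\<close>. On the range
    of \<open>a y - x z\<close>, where \<open>x\<close> is quasinilpotent, \<open>N\<^sup>2 = a N + x\<close> suggests \<open>y\<^sup>2 N\<close>. \<open>Y\<close> is the sum of both.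
  \<close>
  define q where "q = y * y * (a * y - x * z)"
  define Y where "Y = Mat2 (q * a) (z + q) (z * x + q * x) (- (z * a))"
  \<comment> \<open>The defect on the range of \<open>1 - a * y\<close>, where \<open>Y\<close>
    vanishes. There \<open>x\<close> is zero, so the lower row of \<open>W\<close> is zero.\<close>
  define W where "W = N * Mat2 (1 - a * y) 0 0 (1 - a * y)"
  \<comment> \<open>The defect on the range of \<open>a * y - x * z\<close>: expanding
    \<open>N ^ 3\<close> by \<open>N ^ 2 = a N + x\<close> leaves \<open>- x (y + y ^ 2 N)\<close>.
    On the range of \<open>x * z\<close> there is no defect.\<close>
  define V where "V = Mat2 (x - x\<^sup>2 * z) 0 0 (x - x\<^sup>2 * z) * - (Mat2 y 0 0 y + Mat2 (y * y) 0 0 (y * y) * N)"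
  note defs = N_def q_def Y_def W_def V_def mat2_mult minus_mat2_def plus_mat2_def uminus_mat2_def
    zero_mat2_def power2_eq_square algebra_simps comm absorb
  have "W * W = W * Mat2 (a - a\<^sup>2 * y) 0 0 (a - a\<^sup>2 * y)"
    by (simp add: defs)
  then have "quasinilpotent W"
    by (rule quasinilpotent_if_square_eq[rotated]) (simp add: quasinilpotent_mat2_diag qa)
  moreover have "quasinilpotent V"
    unfolding V_def
  proof (rule quasinilpotent_mult_commute)
    show "quasinilpotent (Mat2 (x - x\<^sup>2 * z) 0 0 (x - x\<^sup>2 * z))"
      by (simp add: quasinilpotent_mat2_diag qx)
  qed (simp add: defs)
  moreover have "W * V = 0" "V * W = 0"
    by (simp_all add: defs)
  ultimately have "quasinilpotent (W + V)"
    by (rule quasinilpotent_add_orthogonal)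
  also have "W + V = N - N\<^sup>2 * Y"
    by (simp add: defs)
  finally have "has_gdrazin_inverse N"
    by (rule has_gdrazin_inverseI[rotated]) (simp add: defs)
  then show ?thesis by (simp add: N_def)
qed

theorem theorem3p6:
  fixes a b c :: "'a::complex_banach_algebra_1"
  assumes "has_gdrazin_inverse a"
    and "b * c * a\<^sup>\<pi> = 0"
    and "a\<^sup>d * b * c = b * c * a\<^sup>d"
  shows "has_gdrazin_inverse (Mat2 a b c 0) \<longleftrightarrow> has_gdrazin_inverse (b * c)"
proof -
  define x where "x = b * c"
  define y where "y = a\<^sup>d"
  have y: "is_gdrazin_inverse a y"
    using assms(1) by (simp add: y_def is_gdrazin_inverse_gdrazin_inverse)
  have ay: "a * y = y * a" and yy: "y = y * a * y"
    using y by (simp_all add: is_gdrazin_inverse_def)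
  have yx: "y * x = x * y" using assms(3) by (simp add: x_def y_def mult.assoc)
  have xp: "x * (a * y) = x"
    using assms(2) by (simp add: x_def y_def spectral_idempotent_def right_diff_distrib)
  \<comment> \<open>Commutation with \<open>y\<close> yields commutation with \<open>a\<close>:
    \<open>x = y * x * a\<close> gives \<open>a * y * x = x\<close>, and then
    \<open>a * x = a * y * x * a = x * a\<close>.\<close>
  have x_eq: "x = y * x * a" using xp ay yx by (metis mult.assoc)
  have px: "a * y * x = x"
    using x_eq yy ay by (metis mult.assoc)
  have ax: "a * x = x * a"
    using x_eq px by (metis mult.assoc)
  show ?thesis
    unfolding has_gdrazin_inverse_mat2_companion_iff[of a b c] x_def[symmetric]
    using has_gdrazin_inverse_if_companion[OF _ ax] has_gdrazin_inverse_companion_if[OF y _ ax xp]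
    by (auto simp: has_gdrazin_inverse_def)
qed

end
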